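(* Let $k\ge 1$ be a fixed integer and let $m=m(n)\le n$. (i) If $m/\log n\to\infty$ as $n\to\infty$, then $\lambda_{2k}(m,n)\ge (1+o(1))\, m^k n^{k-1}/2^{2k-1}$. (ii) If $m=\Omega(1)$, then $\lambda_{2k+1}(m,n)\ge (1+o(1))\,(mn/4)^k$.
   Context: $K_{m,n}$ denotes the complete bipartite graph with vertex classes $M$, $|M|=m$, and $N$, $|N|=n$. A path is alternating if any two adjacent edges of it have different colors; the length of a path is its number of edges. $\lambda_{\ell}(m,n)$ is the maximum $t$ such that there is a $2$-edge-coloring of $K_{m,n}$ in which every pair of vertices is connected by $t$ (not necessarily internally disjoint) alternating paths of length $\ell$; for even $\ell$ only pairs of distinct vertices in the class $N$ of size $n$ are considered, and for odd $\ell$ the pairs consist of one vertex from each class. Asymptotic notation is as $n\to\infty$; rounding to integers is ignored; $\log$ is the natural logarithm.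
   Formalization: In (ii) the hypothesis m = Ω(1) is replaced by m → ∞ (m = ω(1)), since for bounded m the claim can fail: for m = 1, k = 1 the graph K_{1,n} has no path of length 3, so λ_3(1,n) = 0. *)

theory Defs
  imports Complex_Main "HOL-Library.Landau_Symbols"
begin

type_synonym vertex = "nat + nat"

definition class_M :: "nat \<Rightarrow> vertex set" where
  "class_M m = Inl ` {..<m}"

definition class_N :: "nat \<Rightarrow> vertex set" where
  "class_N n = Inr ` {..<n}"

definition Kbip_edges :: "nat \<Rightarrow> nat \<Rightarrow> vertex set set" where
  "Kbip_edges m n = {{x, y} | x y. x \<in> class_M m \<and> y \<in> class_N n}"

text \<open>A path is the list of its vertices, so its length as a path is one less than the length
  of the list. Listing a path from a prescribed end to the other one is unambiguous, so counting
  these lists counts paths as subgraphs.\<close>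

definition path_in :: "'v set set \<Rightarrow> 'v list \<Rightarrow> bool" where
  "path_in E p \<longleftrightarrow> p \<noteq> [] \<and> distinct p \<and> (\<forall>i. Suc i < length p \<longrightarrow> {p ! i, p ! Suc i} \<in> E)"

text \<open>A 2-edge-colouring is a function from vertex sets to \<^typ>\<open>bool\<close>; only its values on edges
  are ever used.\<close>

definition alternating :: "('v set \<Rightarrow> bool) \<Rightarrow> 'v list \<Rightarrow> bool" where
  "alternating c p \<longleftrightarrow> (\<forall>i. Suc (Suc i) < length p \<longrightarrow>
     c {p ! i, p ! Suc i} \<noteq> c {p ! Suc i, p ! Suc (Suc i)})"

definition alt_paths ::
    "'v set set \<Rightarrow> ('v set \<Rightarrow> bool) \<Rightarrow> nat \<Rightarrow> 'v \<Rightarrow> 'v \<Rightarrow> 'v list set" where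
  "alt_paths E c l x y =
     {p. path_in E p \<and> alternating c p \<and> length p = Suc l \<and> hd p = x \<and> last p = y}"

definition relevant_pairs :: "nat \<Rightarrow> nat \<Rightarrow> nat \<Rightarrow> (vertex \<times> vertex) set" where
  "relevant_pairs l m n =
     (if even l then {(x, y). x \<in> class_N n \<and> y \<in> class_N n \<and> x \<noteq> y}
      else class_M m \<times> class_N n)"

definition alt_connected :: "nat \<Rightarrow> nat \<Rightarrow> nat \<Rightarrow> nat \<Rightarrow> bool" where
  "alt_connected l m n t \<longleftrightarrow> (\<exists>c. \<forall>(x, y) \<in> relevant_pairs l m n.
     t \<le> card (alt_paths (Kbip_edges m n) c l x y))"

text \<open>The maximum is only meaningful if there is some pair of vertices to connect, see
  \<open>alt_lambda_max\<close> below.\<close>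

definition alt_lambda :: "nat \<Rightarrow> nat \<Rightarrow> nat \<Rightarrow> nat" where
  "alt_lambda l m n = (GREATEST t. alt_connected l m n t)"

lemma path_in_Kbip_vertices:
  assumes "path_in (Kbip_edges m n) p" "length p \<ge> 2"
  shows "set p \<subseteq> class_M m \<union> class_N n"
proof
  fix v assume "v \<in> set p"
  then obtain i where i: "i < length p" "v = p ! i"
    by (auto simp: in_set_conv_nth)
  obtain j where j: "Suc j < length p" "i = j \<or> i = Suc j"
  proof (cases i)
    case 0
    then show ?thesis using that[of 0] assms(2) by simp
  next
    case (Suc j)
    then show ?thesis using that[of j] i by simp
  qed
  then have "{p ! j, p ! Suc j} \<in> Kbip_edges m n"
    using assms(1) by (simp add: path_in_def)
  moreover have "v \<in> {p ! j, p ! Suc j}" using i j by auto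
  ultimately show "v \<in> class_M m \<union> class_N n"
    unfolding Kbip_edges_def by (smt (verit) UnI1 UnI2 mem_Collect_eq insert_iff empty_iff)
qed

lemma card_alt_paths_le:
  assumes "l \<ge> 1"
  shows "card (alt_paths (Kbip_edges m n) c l x y)
           \<le> card {p. set p \<subseteq> class_M m \<union> class_N n \<and> length p = Suc l}"
proof (rule card_mono)
  show "finite {p. set p \<subseteq> class_M m \<union> class_N n \<and> length p = Suc l}"
    by (rule finite_lists_length_eq) (simp add: class_M_def class_N_def)
  show "alt_paths (Kbip_edges m n) c l x y
          \<subseteq> {p. set p \<subseteq> class_M m \<union> class_N n \<and> length p = Suc l}"
    using assms path_in_Kbip_vertices by (fastforce simp: alt_paths_def)
qed

lemma alt_lambda_max:
  assumes "l \<ge> 1" "relevant_pairs l m n \<noteq> {}"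
  shows "alt_connected l m n (alt_lambda l m n)"
    and "alt_connected l m n t \<Longrightarrow> t \<le> alt_lambda l m n"
proof -
  let ?B = "card {p. set p \<subseteq> class_M m \<union> class_N n \<and> length p = Suc l}"
  have bound: "t \<le> ?B" if t: "alt_connected l m n t" for t
  proof -
    obtain c x y where "t \<le> card (alt_paths (Kbip_edges m n) c l x y)"
      using t assms(2) by (fastforce simp: alt_connected_def)
    also have "\<dots> \<le> ?B" by (rule card_alt_paths_le[OF assms(1)])
    finally show ?thesis .
  qed
  have "alt_connected l m n 0" by (auto simp: alt_connected_def)
  then show "alt_connected l m n (alt_lambda l m n)"
    unfolding alt_lambda_def using bound by (rule GreatestI_nat)
  show "t \<le> alt_lambda l m n" if "alt_connected l m n t"
    unfolding alt_lambda_def using that bound by (rule Greatest_le_nat)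
qed

text \<open>A path with three edges visits two vertices of each class. Hence the lower bound
  \<open>(1 + o(1)) mn/4\<close> for length 3 fails for the constant sequence \<open>m = 1\<close>, and the growth condition
  on \<open>m\<close> for odd lengths has to be \<open>m = \<omega>(1)\<close>, not merely \<open>m = \<Omega>(1)\<close>.\<close>

lemma alt_lambda_3_1:
  assumes "n \<ge> 1"
  shows "alt_lambda 3 1 n = 0"
proof -
  have pair: "(Inl 0, Inr 0) \<in> relevant_pairs 3 1 n"
    using assms by (auto simp: relevant_pairs_def class_M_def class_N_def)
  have empty: "alt_paths (Kbip_edges 1 n) c 3 x y = {}" for c x y
  proof -
    have False if p: "p \<in> alt_paths (Kbip_edges 1 n) c 3 x y" for p
    proof -
      have e: "Inl 0 \<in> e" if "e \<in> Kbip_edges 1 n" for e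
        using that by (auto simp: Kbip_edges_def class_M_def)
      have "path_in (Kbip_edges 1 n) p" and len: "length p = 4"
        using p by (auto simp: alt_paths_def)
      then have d: "distinct p"
        and "{p ! 0, p ! Suc 0} \<in> Kbip_edges 1 n"
        and "{p ! 2, p ! Suc 2} \<in> Kbip_edges 1 n"
        unfolding path_in_def by (auto dest: spec[of _ 0] spec[of _ 2])
      then have "Inl 0 \<in> {p ! 0, p ! Suc 0}" "Inl 0 \<in> {p ! 2, p ! Suc 2}"
        using e by blast+
      then show False
        using d len by (auto simp: nth_eq_iff_index_eq dest: sym)
    qed
    then show ?thesis by blast
  qed
  have "alt_connected 3 1 n (alt_lambda 3 1 n)"
    using pair by (intro alt_lambda_max) auto
  then obtain c where
    "alt_lambda 3 1 n \<le> card (alt_paths (Kbip_edges 1 n) c 3 (Inl 0) (Inr 0))"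
    using pair unfolding alt_connected_def by blast
  then show ?thesis
    unfolding empty by simp
qed

end

theory Submission
  imports Defs "HOL-Real_Asymp.Real_Asymp"
begin

text \<open>
  Call a 2-colouring balanced for one vertex class if any two vertices \<open>u \<noteq> w\<close> of that class have
  about a quarter of the other class joined to \<open>u\<close> in the first colour and to \<open>w\<close> in the second.
  A random colouring is balanced by a Chernoff bound as soon as the other class is much larger than
  the logarithm of the first; here the random choice is derandomised, picking one vertex of the
  other class after another so that an exponential potential does not exceed its average.

  In a colouring balanced for \<open>N\<close>, an alternating path of length \<open>2k\<close> between two vertices of \<open>N\<close>
  is obtained by choosing a starting colour, the \<open>k - 1\<close> inner vertices in \<open>N\<close> almost freely, and
  then each of the \<open>k\<close> connecting vertices in \<open>M\<close> in about \<open>m/4\<close> ways. For odd length the colouring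
  is balanced for \<open>M\<close>, which only needs \<open>n\<close> to be much larger than \<open>log m\<close>; all \<open>k\<close> further
  vertices in \<open>M\<close> are almost free, the last of them dictates the starting colour, and each of the
  \<open>k\<close> connecting vertices in \<open>N\<close> has about \<open>n/4\<close> choices.
\<close>

section \<open>Balanced codes by the method of conditional expectations\<close>

lemma card_subsets_separating:
  assumes "finite P" "i \<in> P" "j \<in> P" "i \<noteq> j"
  shows "4 * card {G \<in> Pow P. i \<in> G \<and> j \<notin> G} = 2 ^ card P"
proof -
  define Q where "Q = P - {i, j}"
  have P: "P = insert i (insert j Q)" and Q: "i \<notin> Q" "j \<notin> Q" "finite Q"
    using assms by (auto simp: Q_def)
  have "{G \<in> Pow P. i \<in> G \<and> j \<notin> G} = insert i ` Pow Q"
  proof (intro equalityI subsetI)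
    fix G assume "G \<in> {G \<in> Pow P. i \<in> G \<and> j \<notin> G}"
    then have "G = insert i (G - {i})" "G - {i} \<in> Pow Q" by (auto simp: P)
    then show "G \<in> insert i ` Pow Q" by blast
  qed (use assms Q in \<open>auto simp: P\<close>)
  moreover have "inj_on (insert i) (Pow Q)"
    using Q(1) by (intro inj_onI) (metis PowD insert_ident subsetD)
  ultimately have "card {G \<in> Pow P. i \<in> G \<and> j \<notin> G} = 2 ^ card Q"
    using Q by (simp add: card_image card_Pow)
  moreover have "card P = Suc (Suc (card Q))"
    using Q assms(4) by (simp add: P)
  ultimately show ?thesis by simp
qed

text \<open>Averaging over all \<open>2 ^ p\<close> columns: a uniformly random column separates a
  given ordered pair with probability 1/4, so each factor has mean \<open>(3 + z) / 4\<close>, and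
  some column does no worse than the mean.\<close>

lemma exists_column_le_average:
  fixes w :: "nat \<Rightarrow> nat \<Rightarrow> real" and z :: real
  defines "I p \<equiv> {(i, j). i < p \<and> j < p \<and> i \<noteq> j}"
  shows "\<exists>g :: nat \<Rightarrow> bool.
    (\<Sum>(i, j)\<in>I p. w i j * (if g i \<and> \<not> g j then z else 1)) \<le> (3 + z) / 4 * (\<Sum>(i, j)\<in>I p. w i j)"
proof (rule ccontr)
  let ?W = "\<lambda>G. \<Sum>(i, j)\<in>I p. w i j * (if i \<in> G \<and> j \<notin> G then z else 1)"
  let ?P = "Pow {..<p}"
  assume neg: "\<not> ?thesis"
  have "(3 + z) / 4 * (\<Sum>(i, j)\<in>I p. w i j) < ?W G" for G
    using neg by (auto simp: not_le dest: spec[of _ "\<lambda>i. i \<in> G"])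
  then have "(\<Sum>G\<in>?P. (3 + z) / 4 * (\<Sum>(i, j)\<in>I p. w i j)) < (\<Sum>G\<in>?P. ?W G)"
    by (intro sum_strict_mono) auto
  also have "(\<Sum>G\<in>?P. ?W G) =
      (\<Sum>(i, j)\<in>I p. w i j * (\<Sum>G\<in>?P. if i \<in> G \<and> j \<notin> G then z else 1))"
    by (subst sum.swap) (simp add: case_prod_unfold sum_distrib_left)
  also have "\<dots> = (\<Sum>(i, j)\<in>I p. w i j * (2 ^ p * ((3 + z) / 4)))"
  proof (rule sum.cong[OF refl], clarify)
    fix i j assume "(i, j) \<in> I p"
    then have ij: "4 * card {G \<in> ?P. i \<in> G \<and> j \<notin> G} = 2 ^ p"
      using card_subsets_separating[of "{..<p}" i j] by (simp add: I_def)
    have "(\<Sum>G\<in>?P. if i \<in> G \<and> j \<notin> G then z else 1) =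
        (\<Sum>G\<in>?P. 1 + (z - 1) * (if i \<in> G \<and> j \<notin> G then 1 else 0))"
      by (intro sum.cong) auto
    also have "\<dots> = 2 ^ p + (z - 1) * real (card {G \<in> ?P. i \<in> G \<and> j \<notin> G})"
      by (simp add: sum.distrib card_Pow flip: sum_distrib_left sum.inter_filter)
    also have "real (card {G \<in> ?P. i \<in> G \<and> j \<notin> G}) = 2 ^ p / 4"
      using arg_cong[OF ij, of real] by simp
    finally show "w i j * (\<Sum>G\<in>?P. if i \<in> G \<and> j \<notin> G then z else 1) =
        w i j * (2 ^ p * ((3 + z) / 4))"
      by (simp add: field_simps)
  qed
  also have "\<dots> = (\<Sum>G\<in>?P. (3 + z) / 4 * (\<Sum>(i, j)\<in>I p. w i j))"
    unfolding case_prod_unfold sum_distrib_right[symmetric] by (simp add: card_Pow)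
  finally show False by simp
qed

text \<open>One step of the derandomisation per column: the current potential serves as the weights
  for choosing the next column, so each step costs a factor of at most \<open>(3 + z) / 4\<close>.
  The start value is the number of ordered pairs, at most \<open>p\<^sup>2\<close>.\<close>

lemma exists_columns_le_average:
  fixes z :: real
  assumes "z \<ge> 0"
  defines "I p \<equiv> {(i, j). i < p \<and> j < p \<and> i \<noteq> j}"
  shows "\<exists>f :: nat \<Rightarrow> nat \<Rightarrow> bool.
    (\<Sum>(i, j)\<in>I p. z ^ card {v. v < q \<and> f i v \<and> \<not> f j v}) \<le> real p ^ 2 * ((3 + z) / 4) ^ q"
proof (induction q)
  case 0
  have "I p \<subseteq> {..<p} \<times> {..<p}" by (auto simp: I_def)
  then have "card (I p) \<le> card ({..<p} \<times> {..<p})" by (intro card_mono) auto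
  then have "real (card (I p)) \<le> real (p * p)" by (intro of_nat_mono) simp
  then show ?case by (simp add: case_prod_unfold power2_eq_square)
next
  case (Suc q)
  then obtain f where f: "(\<Sum>(i, j)\<in>I p. z ^ card {v. v < q \<and> f i v \<and> \<not> f j v})
      \<le> real p ^ 2 * ((3 + z) / 4) ^ q" by blast
  obtain g :: "nat \<Rightarrow> bool" where g: "(\<Sum>(i, j)\<in>I p. z ^ card {v. v < q \<and> f i v \<and> \<not> f j v} *
      (if g i \<and> \<not> g j then z else 1))
      \<le> (3 + z) / 4 * (\<Sum>(i, j)\<in>I p. z ^ card {v. v < q \<and> f i v \<and> \<not> f j v})"
    using exists_column_le_average[where p = p and w = "\<lambda>i j. z ^ card {v. v < q \<and> f i v \<and> \<not> f j v}"]
    unfolding I_def by blast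
  let ?f = "\<lambda>i. (f i)(q := g i)"
  have "{v. v < Suc q \<and> ?f i v \<and> \<not> ?f j v} =
      (if g i \<and> \<not> g j then insert q {v. v < q \<and> f i v \<and> \<not> f j v}
       else {v. v < q \<and> f i v \<and> \<not> f j v})" for i j
    by (auto simp: less_Suc_eq)
  then have "z ^ card {v. v < Suc q \<and> ?f i v \<and> \<not> ?f j v} =
      z ^ card {v. v < q \<and> f i v \<and> \<not> f j v} * (if g i \<and> \<not> g j then z else 1)" for i j
    by simp
  then have "(\<Sum>(i, j)\<in>I p. z ^ card {v. v < Suc q \<and> ?f i v \<and> \<not> ?f j v})
      \<le> (3 + z) / 4 * (\<Sum>(i, j)\<in>I p. z ^ card {v. v < q \<and> f i v \<and> \<not> f j v})"
    using g by simp
  also have "\<dots> \<le> (3 + z) / 4 * (real p ^ 2 * ((3 + z) / 4) ^ q)"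
    using f assms by (intro mult_left_mono) auto
  finally show ?case by (intro exI[of _ ?f]) (simp add: mult_ac)
qed

text \<open>Chernoff bound for the lower tail: with a base slightly below 1, a single pair separated
  by too few columns would already exceed the bound on the whole potential.\<close>

lemma exists_balanced_code:
  fixes \<delta> :: real
  assumes \<delta>: "0 < \<delta>" "\<delta> \<le> 1" and small: "real p ^ 2 * exp (- (\<delta>\<^sup>2 * real q / 32)) < 1"
  shows "\<exists>f :: nat \<Rightarrow> nat \<Rightarrow> bool. \<forall>i<p. \<forall>j<p. i \<noteq> j \<longrightarrow>
    (1 - \<delta>) * real q / 4 \<le> real (card {v. v < q \<and> f i v \<and> \<not> f j v})"
proof -
  define I where "I = {(i, j). i < p \<and> j < p \<and> i \<noteq> j}"
  have finI: "finite I"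
    by (rule finite_subset[of _ "{..<p} \<times> {..<p}"]) (auto simp: I_def)
  \<comment> \<open>This choice maximises \<open>s * \<delta> - 2 * s\<^sup>2\<close>, the gain in
    the exponent below; the maximum is \<open>\<delta>\<^sup>2 / 8\<close>.\<close>
  define s where "s = \<delta> / 4"
  have s: "0 < s" "s \<le> 1/2" using \<delta> by (auto simp: s_def)
  obtain f :: "nat \<Rightarrow> nat \<Rightarrow> bool" where
    f: "(\<Sum>(i, j)\<in>I. (1 - s) ^ card {v. v < q \<and> f i v \<and> \<not> f j v}) \<le> real p ^ 2 * ((3 + (1 - s)) / 4) ^ q"
    using exists_columns_le_average[of "1 - s" q p] s unfolding I_def by auto
  have "(1 - \<delta>) * real q / 4 \<le> real (card {v. v < q \<and> f i v \<and> \<not> f j v})"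
    if ij: "i < p" "j < p" "i \<noteq> j" for i j
  proof (rule ccontr)
    let ?t = "card {v. v < q \<and> f i v \<and> \<not> f j v}"
    assume "\<not> ?thesis"
    then have t: "real ?t \<le> (1 - \<delta>) * real q / 4" by simp
    have "(1 - s) ^ ?t = (\<Sum>(i, j)\<in>{(i, j)}. (1 - s) ^ card {v. v < q \<and> f i v \<and> \<not> f j v})" by simp
    also have "\<dots> \<le> (\<Sum>(i, j)\<in>I. (1 - s) ^ card {v. v < q \<and> f i v \<and> \<not> f j v})"
      using ij s finI by (intro sum_mono2) (auto simp: I_def)
    also note f
    also have "real p ^ 2 * ((3 + (1 - s)) / 4) ^ q \<le> real p ^ 2 * exp (- s / 4) ^ q"
      using s exp_ge_add_one_self[of "- s / 4"] by (intro mult_left_mono power_mono) auto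
    also have "\<dots> = real p ^ 2 * exp (- s * real q / 4)"
      by (simp flip: exp_of_nat_mult add: mult_ac)
    finally have up: "(1 - s) ^ ?t \<le> real p ^ 2 * exp (- s * real q / 4)" .
    \<comment> \<open>Now the opposite estimate: since \<open>ln (1 - s)\<close> is at least
      \<open>- s - 2 * s\<^sup>2\<close>, a small \<open>?t\<close> makes
      \<open>(1 - s) ^ ?t\<close> at least
      \<open>exp (\<delta>\<^sup>2 * q / 32 - s * q / 4)\<close>. Comparison with the upper bound
      contradicts \<open>small\<close>.\<close>
    have "(s + 2 * s\<^sup>2) * real ?t \<le> (s + 2 * s\<^sup>2) * ((1 - \<delta>) * real q / 4)"
      using s t by (intro mult_left_mono) auto
    moreover have "(s + 2 * s\<^sup>2) * (1 - \<delta>) \<le> s - \<delta>\<^sup>2 / 8"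
    proof -
      have "(s + 2 * s\<^sup>2) * (1 - \<delta>) = s - \<delta>\<^sup>2 / 8 - 2 * s\<^sup>2 * \<delta>"
        by (simp add: s_def field_simps power2_eq_square)
      then show ?thesis using \<delta> by simp
    qed
    then have "(s + 2 * s\<^sup>2) * (1 - \<delta>) * (real q / 4) \<le> (s - \<delta>\<^sup>2 / 8) * (real q / 4)"
      by (intro mult_right_mono) auto
    moreover have "(s - \<delta>\<^sup>2 / 8) * (real q / 4) = s * real q / 4 - \<delta>\<^sup>2 * real q / 32"
      by (simp add: algebra_simps)
    ultimately have "(s + 2 * s\<^sup>2) * real ?t \<le> s * real q / 4 - \<delta>\<^sup>2 * real q / 32"
      by (simp only: mult.assoc times_divide_eq_right)
    then have "exp (\<delta>\<^sup>2 * real q / 32 - s * real q / 4) \<le> exp (real ?t * (- s - 2 * s\<^sup>2))"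
      by (simp add: algebra_simps)
    also have "\<dots> \<le> exp (real ?t * ln (1 - s))"
      using ln_one_minus_pos_lower_bound[of s] s by (simp add: mult_left_mono)
    also have "\<dots> = (1 - s) ^ ?t"
      using s by (simp add: exp_of_nat_mult)
    also note up
    finally have "exp (\<delta>\<^sup>2 * real q / 32 - s * real q / 4) * exp (s * real q / 4 - \<delta>\<^sup>2 * real q / 32)
        \<le> real p ^ 2 * exp (- s * real q / 4) * exp (s * real q / 4 - \<delta>\<^sup>2 * real q / 32)"
      by (rule mult_right_mono) simp
    then have "1 \<le> real p ^ 2 * exp (- (\<delta>\<^sup>2 * real q / 32))"
      by (simp add: mult.assoc flip: exp_add)
    then show False using small by simp
  qed
  then show ?thesis by blast
qed

section \<open>Alternating paths through a spine: soundness and counting\<close>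

text \<open>Splitting off index 0 turns the index-based definitions of path and alternation into
  recursions on the list.\<close>

lemma all_nat_iff_0_Suc: "(\<forall>i::nat. P i) \<longleftrightarrow> P 0 \<and> (\<forall>i. P (Suc i))"
proof (intro iffI allI)
  fix i assume "P 0 \<and> (\<forall>i. P (Suc i))"
  then show "P i" by (cases i) auto
qed auto

lemma path_in_Cons_Cons:
  "path_in E (x # y # p) \<longleftrightarrow> x \<notin> set (y # p) \<and> {x, y} \<in> E \<and> path_in E (y # p)"
proof -
  have "(\<forall>i. Suc i < length (x # y # p) \<longrightarrow> {(x # y # p) ! i, (x # y # p) ! Suc i} \<in> E) \<longleftrightarrow>
    {x, y} \<in> E \<and> (\<forall>i. Suc i < length (y # p) \<longrightarrow> {(y # p) ! i, (y # p) ! Suc i} \<in> E)"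
    by (rule trans[OF all_nat_iff_0_Suc]) simp
  then show ?thesis unfolding path_in_def distinct.simps by blast
qed

lemma alternating_Cons_Cons_Cons:
  "alternating c (x # y # z # p) \<longleftrightarrow> c {x, y} \<noteq> c {y, z} \<and> alternating c (y # z # p)"
  unfolding alternating_def by (rule trans[OF all_nat_iff_0_Suc]) simp

text \<open>\<open>spine_paths A B c a T k x F\<close> consists of paths \<open>x, b\<^sub>0, s\<^sub>1, b\<^sub>1, \<dots>, s\<^sub>k, b\<^sub>k\<close> followed by the
  fixed tail \<open>T\<close>, where the \<open>s\<^sub>i\<close> lie in \<open>A\<close>, the \<open>b\<^sub>i\<close> lie in \<open>B\<close>, both avoid \<open>F\<close>, and every edge
  leading from \<open>A\<close> to \<open>B\<close> has colour \<open>a\<close>.\<close>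

definition connectors ::
    "'v set \<Rightarrow> ('v set \<Rightarrow> bool) \<Rightarrow> bool \<Rightarrow> 'v \<Rightarrow> 'v \<Rightarrow> 'v set" where
  "connectors B c a u w = {b \<in> B. c {u, b} = a \<and> c {b, w} = (\<not> a)}"

primrec spine_paths ::
    "'v set \<Rightarrow> 'v set \<Rightarrow> ('v set \<Rightarrow> bool) \<Rightarrow> bool \<Rightarrow> 'v list \<Rightarrow> nat \<Rightarrow> 'v \<Rightarrow> 'v set \<Rightarrow> 'v list set" where
  "spine_paths A B c a T 0 x F = (\<lambda>b. x # b # T) ` (connectors B c a x (hd T) - F)"
| "spine_paths A B c a T (Suc k) x F =
     (\<lambda>((s, b), p). x # b # p) `
       (SIGMA (s, b) : (SIGMA s : A - F - {x}. connectors B c a x s - F).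
          spine_paths A B c a T k s (F \<union> {x, b}))"

text \<open>The head, the colour of the first edge and the avoidance of \<open>F\<close> outside
  \<open>T\<close> are what the induction needs to prepend two more vertices. The colour and the
  suffix \<open>T\<close> also serve later to show that families of paths are disjoint.\<close>

lemma spine_paths_sound:
  assumes "A \<inter> B = {}" and edges: "\<And>u b. u \<in> A \<Longrightarrow> b \<in> B \<Longrightarrow> {u, b} \<in> E"
    and T: "T \<noteq> []" "hd T \<in> A" "path_in E T"
      "\<And>b. b \<in> B \<Longrightarrow> c {b, hd T} = (\<not> a) \<Longrightarrow> alternating c (b # T)"
  shows "p \<in> spine_paths A B c a T k x F \<Longrightarrow> x \<in> A - F \<Longrightarrow> set T \<subseteq> F \<Longrightarrow>
    path_in E p \<and> alternating c p \<and> set p \<subseteq> set T \<union> - F \<and> length p = 2 * k + 2 + length T \<and>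
    hd p = x \<and> c {x, p ! 1} = a \<and> (\<exists>q. p = q @ T)"
proof (induction k arbitrary: p x F)
  case 0
  then obtain b where p: "p = x # b # T" and b: "b \<in> B" "c {x, b} = a" "c {b, hd T} = (\<not> a)" "b \<notin> F"
    by (auto simp: connectors_def)
  obtain s T' where T': "T = s # T'" using T(1) by (cases T) auto
  have "b \<noteq> x" using b 0 assms(1) by auto
  then show ?case
    using 0 b T(4)[of b] T edges[of x b] edges[of s b]
    by (auto simp: p T' path_in_Cons_Cons alternating_Cons_Cons_Cons insert_commute)
next
  case (Suc k)
  then obtain s b p' where p: "p = x # b # p'" and s: "s \<in> A - F - {x}"
    and b: "b \<in> B" "c {x, b} = a" "c {b, s} = (\<not> a)" "b \<notin> F"
    and p': "p' \<in> spine_paths A B c a T k s (F \<union> {x, b})"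
    by (auto simp: connectors_def)
  have ne: "b \<noteq> x" "b \<noteq> s" using b s Suc.prems assms(1) by auto
  have IH: "path_in E p'" "alternating c p'" "set p' \<subseteq> set T \<union> - (F \<union> {x, b})"
    "length p' = 2 * k + 2 + length T" "hd p' = s" "c {s, p' ! 1} = a" "\<exists>q. p' = q @ T"
    using Suc.IH[OF p'] s ne Suc.prems by auto
  obtain y p'' where p'': "p' = s # y # p''"
    using IH(4,5) by (cases p'; cases "tl p'") auto
  obtain q where "p' = q @ T" using IH(7) by blast
  then have "p = (x # b # q) @ T" by (simp add: p)
  then have "\<exists>q. p = q @ T" by blast
  moreover have "x \<notin> set p'" "b \<notin> set p'" using IH(3) Suc.prems(2,3) b(4) by auto
  then have "path_in E p"
    using IH(1) b(1) s ne Suc.prems(2) edges[of x b] edges[of s b]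
    by (simp add: p p'' path_in_Cons_Cons insert_commute)
  moreover have "alternating c p"
    using IH(2,6) b(2,3) by (simp add: p p'' alternating_Cons_Cons_Cons)
  moreover have "set p \<subseteq> set T \<union> - F" using IH(3) Suc.prems(2) b(4) by (auto simp: p)
  ultimately show ?case using IH(4) b(2) by (simp add: p)
qed

text \<open>Greedy choice of \<open>k\<close> spine vertices and \<open>Suc k\<close> connectors.
  Each round adds two vertices to \<open>F\<close>, so \<open>R\<close> bounds the number of
  forbidden vertices at every choice. Finiteness is carried along so that the cardinalities add
  up.\<close>

lemma card_spine_paths_ge:
  assumes fin: "finite A" "finite B" and disj: "A \<inter> B = {}"
    and conn: "\<And>u w. u \<in> A \<Longrightarrow> w \<in> A \<Longrightarrow> u \<noteq> w \<Longrightarrow> D \<le> card (connectors B c a u w)"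
    and T: "T \<noteq> []" "hd T \<in> A"
  shows "x \<in> A - F \<Longrightarrow> set T \<subseteq> F \<Longrightarrow> finite F \<Longrightarrow> card F + 2 * k \<le> R \<Longrightarrow>
    finite (spine_paths A B c a T k x F) \<and>
    (card A - R) ^ k * (D - R) ^ Suc k \<le> card (spine_paths A B c a T k x F)"
proof (induction k arbitrary: x F)
  case 0
  have fC: "finite (connectors B c a x (hd T))" using fin by (simp add: connectors_def)
  have "x \<noteq> hd T" using 0 T by (cases T) auto
  then have "D - R \<le> card (connectors B c a x (hd T)) - card F"
    using conn[of x "hd T"] 0 T by (intro diff_le_mono order_trans[OF diff_le_mono2 diff_le_mono]) auto
  also have "\<dots> \<le> card (connectors B c a x (hd T) - F)"
    using 0 by (intro diff_card_le_card_Diff)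
  finally show ?case
    using fC by (simp add: card_image inj_on_def)
next
  case (Suc k)
  have fC: "finite (connectors B c a u w)" for u w using fin by (simp add: connectors_def)
  let ?I = "SIGMA s : A - F - {x}. connectors B c a x s - F"
  let ?S = "\<lambda>(s, b). spine_paths A B c a T k s (F \<union> {x, b})"
  have IH: "finite (?S i) \<and> (card A - R) ^ k * (D - R) ^ Suc k \<le> card (?S i)"
    and hd: "p \<in> ?S i \<Longrightarrow> hd p = fst i" if iI: "i \<in> ?I" for i p
  proof -
    obtain s b where i: "i = (s, b)" and s: "s \<in> A - F - {x}" and b: "b \<in> B" "b \<notin> F"
      using iI by (auto simp: connectors_def)
    have "s \<noteq> b" using s b disj by auto
    moreover have "card (F \<union> {x, b}) \<le> card F + 2"
      using Suc.prems(3) card_Un_le[of F "{x, b}"] by (auto simp: card_insert_if split: if_splits)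
    ultimately show "finite (?S i) \<and> (card A - R) ^ k * (D - R) ^ Suc k \<le> card (?S i)"
      using Suc.IH[of s "F \<union> {x, b}"] s Suc.prems by (auto simp: i)
    show "p \<in> ?S i \<Longrightarrow> hd p = fst i"
      by (cases k) (auto simp: i)
  qed
  have finI: "finite ?I" using fin fC by auto
  \<comment> \<open>The list \<open>x # b # p\<close> does not mention \<open>s\<close> separately,
    but \<open>s\<close> is the head of \<open>p\<close>, so the choice can be recovered.\<close>
  have inj: "inj_on (\<lambda>((s, b), p). x # b # p) (Sigma ?I ?S)"
  proof (rule inj_onI)
    fix u v assume u: "u \<in> Sigma ?I ?S" and v: "v \<in> Sigma ?I ?S"
      and eq: "(\<lambda>((s, b), p). x # b # p) u = (\<lambda>((s, b), p). x # b # p) v"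
    obtain s b p s' b' p' where uv: "u = ((s, b), p)" "v = ((s', b'), p')"
      by (metis surj_pair)
    then have "hd p = s" "hd p' = s'" using hd[of "(s, b)" p] hd[of "(s', b')" p'] u v by auto
    then show "u = v" using eq uv by simp
  qed
  have "(card A - R) * (D - R) \<le> card ?I"
  proof -
    have 1: "D - R \<le> card (connectors B c a x s - F)" if "s \<in> A - F - {x}" for s
    proof -
      have "D - R \<le> card (connectors B c a x s) - card F"
        using conn[of x s] that Suc.prems by (intro order_trans[OF diff_le_mono2 diff_le_mono]) auto
      also have "\<dots> \<le> card (connectors B c a x s - F)"
        using Suc.prems by (intro diff_card_le_card_Diff)
      finally show ?thesis .
    qed
    have "card A - R \<le> card A - card (insert x F)"
      using Suc.prems by (intro diff_le_mono2) (simp add: card_insert_if)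
    also have "\<dots> \<le> card (A - insert x F)"
      using Suc.prems by (intro diff_card_le_card_Diff) auto
    also have "A - insert x F = A - F - {x}" by auto
    finally have "(card A - R) * (D - R) \<le> card (A - F - {x}) * (D - R)" by simp
    also have "\<dots> = (\<Sum>s\<in>A - F - {x}. D - R)" by simp
    also have "\<dots> \<le> (\<Sum>s\<in>A - F - {x}. card (connectors B c a x s - F))"
      by (intro sum_mono 1)
    also have "\<dots> = card ?I" using fin fC by simp
    finally show ?thesis .
  qed
  then have "(card A - R) * (D - R) * ((card A - R) ^ k * (D - R) ^ Suc k)
      \<le> card ?I * ((card A - R) ^ k * (D - R) ^ Suc k)" by (rule mult_right_mono) simp
  also have "\<dots> = (\<Sum>i\<in>?I. (card A - R) ^ k * (D - R) ^ Suc k)" by simp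
  also have "\<dots> \<le> (\<Sum>i\<in>?I. card (?S i))"
    using IH by (intro sum_mono) blast
  also have "\<dots> = card (Sigma ?I ?S)"
    using finI IH by (subst card_SigmaI) auto
  also have "\<dots> = card (spine_paths A B c a T (Suc k) x F)"
    using inj by (simp add: card_image case_prod_unfold)
  finally have "(card A - R) ^ Suc k * (D - R) ^ Suc (Suc k)
      \<le> card (spine_paths A B c a T (Suc k) x F)" by (simp add: mult_ac)
  moreover have "finite (Sigma ?I ?S)" by (rule finite_SigmaI[OF finI]) (use IH in blast)
  then have "finite (spine_paths A B c a T (Suc k) x F)" by (simp add: case_prod_unfold)
  ultimately show ?case by blast
qed

section \<open>Explicit lower bounds from a balanced code\<close>

lemma finite_alt_paths:
  assumes "l \<ge> 1"
  shows "finite (alt_paths (Kbip_edges m n) c l x y)"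
proof (rule finite_subset)
  show "alt_paths (Kbip_edges m n) c l x y
      \<subseteq> {p. set p \<subseteq> class_M m \<union> class_N n \<and> length p = Suc l}"
    using assms path_in_Kbip_vertices by (fastforce simp: alt_paths_def)
qed (rule finite_lists_length_eq, simp add: class_M_def class_N_def)

text \<open>The rows of the code are the vertices of \<open>N\<close>, its columns those of
  \<open>M\<close>. Paths to \<open>y\<close> have \<open>k - 1\<close> free inner vertices in
  \<open>N\<close> and \<open>k\<close> connectors in \<open>M\<close>, and the two starting colours
  account for the factor 2.\<close>

lemma alt_lambda_even_ge:
  assumes "k \<ge> 1" "n \<ge> 2"
    and f: "\<And>i j. i < n \<Longrightarrow> j < n \<Longrightarrow> i \<noteq> j \<Longrightarrow> D \<le> card {v. v < m \<and> f i v \<and> \<not> f j v}"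
  shows "2 * ((n - 2 * k) ^ (k - 1) * (D - 2 * k) ^ k) \<le> alt_lambda (2 * k) m n"
proof (rule alt_lambda_max(2))
  have "(Inr 0, Inr 1) \<in> relevant_pairs (2 * k) m n"
    using assms by (auto simp: relevant_pairs_def class_N_def)
  then show "relevant_pairs (2 * k) m n \<noteq> {}" by blast
  show "1 \<le> 2 * k" using assms by simp
  define c :: "vertex set \<Rightarrow> bool" where "c e = (\<exists>v i. e = {Inl v, Inr i} \<and> f i v)" for e
  have c: "c {Inr i, Inl v} = f i v" "c {Inl v, Inr i} = f i v" for i v
    by (auto simp: c_def doubleton_eq_iff)
  have disj: "class_N n \<inter> class_M m = {}" by (auto simp: class_M_def class_N_def)
  have edges: "{u, b} \<in> Kbip_edges m n" if "u \<in> class_N n" "b \<in> class_M m" for u b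
    using that unfolding Kbip_edges_def by (auto simp: insert_commute)
  have conn: "D \<le> card (connectors (class_M m) c a u w)"
    if uw: "u \<in> class_N n" "w \<in> class_N n" "u \<noteq> w" for a u w
  proof -
    obtain i j where ij: "u = Inr i" "w = Inr j" "i < n" "j < n" "i \<noteq> j"
      using uw by (auto simp: class_N_def)
    \<comment> \<open>Exchanging the colours exchanges the two rows; the code bounds ordered pairs,
      so both colours are covered.\<close>
    have "connectors (class_M m) c a u w = Inl `
        (if a then {v. v < m \<and> f i v \<and> \<not> f j v} else {v. v < m \<and> f j v \<and> \<not> f i v})"
      by (auto simp: connectors_def class_M_def ij c)
    then show ?thesis using f[of i j] f[of j i] ij by (simp add: card_image)
  qed
  have "2 * ((n - 2 * k) ^ (k - 1) * (D - 2 * k) ^ k)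
      \<le> card (alt_paths (Kbip_edges m n) c (2 * k) x y)"
    if "(x, y) \<in> relevant_pairs (2 * k) m n" for x y
  proof -
    have xy: "x \<in> class_N n" "y \<in> class_N n" "x \<noteq> y"
      using that by (auto simp: relevant_pairs_def)
    define S where "S a = spine_paths (class_N n) (class_M m) c a [y] (k - 1) x {y}" for a
    have sound: "p \<in> alt_paths (Kbip_edges m n) c (2 * k) x y \<and> c {x, p ! 1} = a" if p: "p \<in> S a" for p a
    proof -
      have "path_in (Kbip_edges m n) p \<and> alternating c p \<and> set p \<subseteq> set [y] \<union> - {y} \<and>
          length p = 2 * (k - 1) + 2 + length [y] \<and> hd p = x \<and> c {x, p ! 1} = a \<and> (\<exists>q. p = q @ [y])"
        by (rule spine_paths_sound[OF disj edges])
          (use p xy in \<open>auto simp: S_def path_in_def alternating_def\<close>)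
      then show ?thesis using assms(1) by (auto simp: alt_paths_def)
    qed
    have card: "finite (S a) \<and> (n - 2 * k) ^ (k - 1) * (D - 2 * k) ^ k \<le> card (S a)" for a
    proof -
      have "finite (S a) \<and>
          (card (class_N n) - 2 * k) ^ (k - 1) * (D - 2 * k) ^ Suc (k - 1) \<le> card (S a)"
        unfolding S_def
        by (rule card_spine_paths_ge[OF _ _ disj conn])
          (use xy assms(1) in \<open>auto simp: class_M_def class_N_def\<close>)
      then show ?thesis using assms(1) by (simp add: class_N_def card_image)
    qed
    have fin: "finite (alt_paths (Kbip_edges m n) c (2 * k) x y)"
      by (rule finite_alt_paths) (use assms in simp)
    \<comment> \<open>The colour of the first edge tells the two families apart.\<close>
    have "S True \<inter> S False = {}" using sound by blast
    then have "card (S True) + card (S False) = card (S True \<union> S False)"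
      using card by (simp add: card_Un_disjoint)
    also have "\<dots> \<le> card (alt_paths (Kbip_edges m n) c (2 * k) x y)"
      using sound fin by (intro card_mono) auto
    finally show ?thesis using card[of True] card[of False] by linarith
  qed
  then show "alt_connected (2 * k) m n (2 * ((n - 2 * k) ^ (k - 1) * (D - 2 * k) ^ k))"
    unfolding alt_connected_def by blast
qed

text \<open>With rows in \<open>M\<close> and columns in \<open>N\<close>, the paths are sorted by
  their last vertex \<open>s\<close> in \<open>M\<close>. The choice of \<open>s\<close> gives one
  factor \<open>m - 2 * k\<close>, the inner spine vertices the other \<open>k - 1\<close>.\<close>

lemma alt_lambda_odd_ge:
  assumes "k \<ge> 1" "m \<ge> 1" "n \<ge> 1"
    and f: "\<And>i j. i < m \<Longrightarrow> j < m \<Longrightarrow> i \<noteq> j \<Longrightarrow> D \<le> card {v. v < n \<and> f i v \<and> \<not> f j v}"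
  shows "(m - 2 * k) ^ k * (D - 2 * k) ^ k \<le> alt_lambda (2 * k + 1) m n"
proof (rule alt_lambda_max(2))
  have "(Inl 0, Inr 0) \<in> relevant_pairs (2 * k + 1) m n"
    using assms by (auto simp: relevant_pairs_def class_N_def class_M_def)
  then show "relevant_pairs (2 * k + 1) m n \<noteq> {}" by blast
  show "1 \<le> 2 * k + 1" by simp
  define c :: "vertex set \<Rightarrow> bool" where "c e = (\<exists>v i. e = {Inl i, Inr v} \<and> f i v)" for e
  have c: "c {Inr v, Inl i} = f i v" "c {Inl i, Inr v} = f i v" for i v
    by (auto simp: c_def doubleton_eq_iff)
  have disj: "class_M m \<inter> class_N n = {}" by (auto simp: class_M_def class_N_def)
  have edges: "{u, b} \<in> Kbip_edges m n" if "u \<in> class_M m" "b \<in> class_N n" for u b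
    using that unfolding Kbip_edges_def by auto
  have conn: "D \<le> card (connectors (class_N n) c a u w)"
    if uw: "u \<in> class_M m" "w \<in> class_M m" "u \<noteq> w" for a u w
  proof -
    obtain i j where ij: "u = Inl i" "w = Inl j" "i < m" "j < m" "i \<noteq> j"
      using uw by (auto simp: class_M_def)
    have "connectors (class_N n) c a u w = Inr `
        (if a then {v. v < n \<and> f i v \<and> \<not> f j v} else {v. v < n \<and> f j v \<and> \<not> f i v})"
      by (auto simp: connectors_def class_N_def ij c)
    then show ?thesis using f[of i j] f[of j i] ij by (simp add: card_image)
  qed
  have "(m - 2 * k) ^ k * (D - 2 * k) ^ k
      \<le> card (alt_paths (Kbip_edges m n) c (2 * k + 1) x y)"
    if "(x, y) \<in> relevant_pairs (2 * k + 1) m n" for x y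
  proof -
    have xy: "x \<in> class_M m" "y \<in> class_N n"
      using that by (auto simp: relevant_pairs_def)
    have neq: "s \<noteq> y" if "s \<in> class_M m" for s
      using that xy by (auto simp: class_M_def class_N_def)
    \<comment> \<open>The last edge must repeat the first colour, so the last vertex \<open>s\<close> in \<open>M\<close> fixes the colouring
      of the whole path: every \<open>s\<close> contributes for exactly one colour.\<close>
    define S where "S s = spine_paths (class_M m) (class_N n) c (c {s, y}) [s, y] (k - 1) x {s, y}" for s
    have sound: "p \<in> alt_paths (Kbip_edges m n) c (2 * k + 1) x y \<and> (\<exists>q. p = q @ [s, y])"
      if s: "s \<in> class_M m - {x}" and p: "p \<in> S s" for p s
    proof -
      have "path_in (Kbip_edges m n) [s, y]"
        using s xy neq by (auto simp: path_in_def Kbip_edges_def)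
      moreover have "alternating c (b # [s, y])" if "c {b, s} = (\<not> c {s, y})" for b
        using that by (auto simp: alternating_def)
      ultimately have "path_in (Kbip_edges m n) p \<and> alternating c p \<and>
          set p \<subseteq> set [s, y] \<union> - {s, y} \<and> length p = 2 * (k - 1) + 2 + length [s, y] \<and>
          hd p = x \<and> c {x, p ! 1} = c {s, y} \<and> (\<exists>q. p = q @ [s, y])"
        using s p xy neq by (intro spine_paths_sound[OF disj edges]) (auto simp: S_def)
      then show ?thesis using assms(1) by (auto simp: alt_paths_def)
    qed
    have card: "finite (S s) \<and> (m - 2 * k) ^ (k - 1) * (D - 2 * k) ^ k \<le> card (S s)"
      if s: "s \<in> class_M m - {x}" for s
    proof -
      have "finite (S s) \<and>
          (card (class_M m) - 2 * k) ^ (k - 1) * (D - 2 * k) ^ Suc (k - 1) \<le> card (S s)"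
        unfolding S_def
        by (rule card_spine_paths_ge[OF _ _ disj conn])
          (use s xy neq assms(1) in \<open>auto simp: class_M_def class_N_def card_insert_if\<close>)
      then show ?thesis using assms(1) by (simp add: class_M_def card_image)
    qed
    have fin: "finite (alt_paths (Kbip_edges m n) c (2 * k + 1) x y)"
      by (rule finite_alt_paths) simp
    have "card (class_M m - {x}) = m - 1"
      using xy by (simp add: class_M_def card_image)
    then have "(m - 2 * k) * ((m - 2 * k) ^ (k - 1) * (D - 2 * k) ^ k)
        \<le> card (class_M m - {x}) * ((m - 2 * k) ^ (k - 1) * (D - 2 * k) ^ k)"
      using assms(1) by (intro mult_right_mono) auto
    also have "\<dots> \<le> (\<Sum>s\<in>class_M m - {x}. card (S s))"
      using card sum_bounded_below[of "class_M m - {x}" "(m - 2 * k) ^ (k - 1) * (D - 2 * k) ^ k"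
          "\<lambda>s. card (S s)"] by simp
    also have "\<dots> = card (\<Union>s\<in>class_M m - {x}. S s)"
    proof (rule card_UN_disjoint[symmetric])
      show "\<forall>s\<in>class_M m - {x}. \<forall>t\<in>class_M m - {x}. s \<noteq> t \<longrightarrow> S s \<inter> S t = {}"
      proof (intro ballI impI equals0I)
        fix s t p assume st: "s \<in> class_M m - {x}" "t \<in> class_M m - {x}" "s \<noteq> t" and p: "p \<in> S s \<inter> S t"
        \<comment> \<open>The last two vertices of \<open>p\<close> determine
          \<open>s\<close>.\<close>
        obtain q q' where "p = q @ [s, y]" "p = q' @ [t, y]"
          using sound[OF st(1), of p] sound[OF st(2), of p] p by blast
        then show False using st(3) by simp
      qed
    qed (use card in \<open>auto simp: class_M_def\<close>)
    also have "\<dots> \<le> card (alt_paths (Kbip_edges m n) c (2 * k + 1) x y)"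
      using sound fin by (intro card_mono) auto
    finally show ?thesis using assms(1) by (cases k) (auto simp: mult.assoc)
  qed
  then show "alt_connected (2 * k + 1) m n ((m - 2 * k) ^ k * (D - 2 * k) ^ k)"
    unfolding alt_connected_def by blast
qed

section \<open>Relative errors of the explicit bounds\<close>

text \<open>One error \<open>\<eta> * r\<close> pays for the deviation of \<open>a\<close> from
  \<open>r\<close>, the other for the excluded vertices. Truncation of the natural difference can
  only raise it.\<close>

lemma real_diff_ge_mult:
  fixes \<eta> r :: real
  assumes "r - \<eta> * r \<le> real a" "real b \<le> \<eta> * r"
  shows "(1 - 2 * \<eta>) * r \<le> real (a - b)"
  using assms by (simp add: algebra_simps of_nat_diff_real)

lemma alt_lambda_even_ge_asymptotic:
  fixes \<eta> :: real
  assumes k: "k \<ge> 1" and \<eta>: "0 < \<eta>" "\<eta> \<le> 1/4"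
    and m: "8 * real k / \<eta> \<le> real m" and n: "8 * real k / \<eta> \<le> real n"
    and small: "real n ^ 2 * exp (- (\<eta>\<^sup>2 * real m / 32)) < 1"
  shows "(1 - 4 * real k * \<eta>) * (real m ^ k * real n ^ (k - 1) / 2 ^ (2 * k - 1))
    \<le> real (alt_lambda (2 * k) m n)"
proof -
  define D where "D = nat \<lceil>(1 - \<eta>) * real m / 4\<rceil>"
  obtain f where f: "\<And>i j. i < n \<Longrightarrow> j < n \<Longrightarrow> i \<noteq> j \<Longrightarrow>
      (1 - \<eta>) * real m / 4 \<le> real (card {v. v < m \<and> f i v \<and> \<not> f j v})"
    using exists_balanced_code[of \<eta> n m] \<eta> small by auto
  \<comment> \<open>The constant is 4 times \<open>2 * k\<close>: as \<open>D\<close> is only about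
    \<open>m / 4\<close>, the loss of \<open>2 * k\<close> has to be at most
    \<open>\<eta> * m / 4\<close>.\<close>
  have mk: "8 * real k \<le> \<eta> * real m" and nk: "8 * real k \<le> \<eta> * real n"
    using m n \<eta> by (simp_all add: field_simps)
  have "\<eta> * real n \<le> 1/4 * real n" using \<eta> by (intro mult_right_mono) auto
  then have "n \<ge> 2" using nk k by simp
  then have "2 * ((n - 2 * k) ^ (k - 1) * (D - 2 * k) ^ k) \<le> alt_lambda (2 * k) m n"
    using f by (intro alt_lambda_even_ge[OF k, of n D m f]) (auto simp: D_def ceiling_le_iff nat_le_iff)
  then have lam: "2 * (real (n - 2 * k) ^ (k - 1) * real (D - 2 * k) ^ k)
      \<le> real (alt_lambda (2 * k) m n)"
    by (metis (mono_tags, lifting) of_nat_le_iff of_nat_mult of_nat_numeral of_nat_power)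
  have \<theta>: "0 \<le> 1 - 2 * \<eta>" "1 - 2 * \<eta> \<le> 1" using \<eta> by auto
  have 1: "(1 - 2 * \<eta>) * real n \<le> real (n - 2 * k)"
    using nk \<eta> by (intro real_diff_ge_mult) auto
  have 2: "(1 - 2 * \<eta>) * (real m / 4) \<le> real (D - 2 * k)"
  proof (rule real_diff_ge_mult)
    show "real m / 4 - \<eta> * (real m / 4) \<le> real D"
      using real_nat_ceiling_ge[of "(1 - \<eta>) * real m / 4"] by (simp add: D_def algebra_simps)
  qed (use mk in simp)
  \<comment> \<open>The product has \<open>2 * k - 1\<close> factors \<open>1 - 2 * \<eta>\<close>;
    one more is allowed for, to get the round loss \<open>4 * k * \<eta>\<close> from
    Bernoulli.\<close>
  have "1 + real (2 * k) * (- (2 * \<eta>)) \<le> (1 + - (2 * \<eta>)) ^ (2 * k)"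
    using \<eta> by (intro Bernoulli_inequality) auto
  also have "\<dots> \<le> (1 - 2 * \<eta>) ^ (k - 1 + k)"
    using \<theta> by (simp, intro power_decreasing) auto
  finally have "1 - 4 * real k * \<eta> \<le> (1 - 2 * \<eta>) ^ (k - 1 + k)" by simp
  then have "(1 - 4 * real k * \<eta>) * (real m ^ k * real n ^ (k - 1) / 2 ^ (2 * k - 1))
      \<le> (1 - 2 * \<eta>) ^ (k - 1 + k) * (real m ^ k * real n ^ (k - 1) / 2 ^ (2 * k - 1))"
    by (rule mult_right_mono) simp
  \<comment> \<open>Of \<open>2 ^ (2 * k - 1) = 4 ^ k / 2\<close>, the power of 4 belongs to the
    \<open>k\<close> connectors and the 2 to the starting colours.\<close>
  also have "\<dots> = (1 - 2 * \<eta>) ^ (k - 1 + k) * (real m ^ k * real n ^ (k - 1) / (4 ^ k / 2))"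
    using k by (cases k) (simp_all add: power_mult)
  also have "\<dots> = 2 * (((1 - 2 * \<eta>) * real n) ^ (k - 1) * ((1 - 2 * \<eta>) * (real m / 4)) ^ k)"
    by (simp add: power_add power_mult_distrib power_divide mult_ac)
  also have "\<dots> \<le> 2 * (real (n - 2 * k) ^ (k - 1) * real (D - 2 * k) ^ k)"
    using 1 2 \<theta> by (intro mult_left_mono mult_mono power_mono) auto
  also note lam
  finally show ?thesis .
qed

lemma alt_lambda_odd_ge_asymptotic:
  fixes \<eta> :: real
  assumes k: "k \<ge> 1" and \<eta>: "0 < \<eta>" "\<eta> \<le> 1/4"
    and m: "8 * real k / \<eta> \<le> real m" and n: "8 * real k / \<eta> \<le> real n"
    and small: "real m ^ 2 * exp (- (\<eta>\<^sup>2 * real n / 32)) < 1"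
  shows "(1 - 4 * real k * \<eta>) * (real m * real n / 4) ^ k \<le> real (alt_lambda (2 * k + 1) m n)"
proof -
  define D where "D = nat \<lceil>(1 - \<eta>) * real n / 4\<rceil>"
  obtain f where f: "\<And>i j. i < m \<Longrightarrow> j < m \<Longrightarrow> i \<noteq> j \<Longrightarrow>
      (1 - \<eta>) * real n / 4 \<le> real (card {v. v < n \<and> f i v \<and> \<not> f j v})"
    using exists_balanced_code[of \<eta> m n] \<eta> small by auto
  have mk: "8 * real k \<le> \<eta> * real m" and nk: "8 * real k \<le> \<eta> * real n"
    using m n \<eta> by (simp_all add: field_simps)
  have "m \<ge> 1" "n \<ge> 1" using mk nk k by (auto simp: Suc_le_eq intro!: Nat.gr0I)
  then have "(m - 2 * k) ^ k * (D - 2 * k) ^ k \<le> alt_lambda (2 * k + 1) m n"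
    using f by (intro alt_lambda_odd_ge[OF k, of m n D f]) (auto simp: D_def ceiling_le_iff nat_le_iff)
  then have lam: "real (m - 2 * k) ^ k * real (D - 2 * k) ^ k \<le> real (alt_lambda (2 * k + 1) m n)"
    by (metis (mono_tags, lifting) of_nat_le_iff of_nat_mult of_nat_power)
  have \<theta>: "0 \<le> 1 - 2 * \<eta>" using \<eta> by auto
  have 1: "(1 - 2 * \<eta>) * real m \<le> real (m - 2 * k)"
    using mk \<eta> by (intro real_diff_ge_mult) auto
  have 2: "(1 - 2 * \<eta>) * (real n / 4) \<le> real (D - 2 * k)"
  proof (rule real_diff_ge_mult)
    show "real n / 4 - \<eta> * (real n / 4) \<le> real D"
      using real_nat_ceiling_ge[of "(1 - \<eta>) * real n / 4"] by (simp add: D_def algebra_simps)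
  qed (use nk in simp)
  have "1 + real (k + k) * (- (2 * \<eta>)) \<le> (1 + - (2 * \<eta>)) ^ (k + k)"
    using \<eta> by (intro Bernoulli_inequality) auto
  then have "1 - 4 * real k * \<eta> \<le> (1 - 2 * \<eta>) ^ (k + k)" by simp
  then have "(1 - 4 * real k * \<eta>) * (real m * real n / 4) ^ k
      \<le> (1 - 2 * \<eta>) ^ (k + k) * (real m * real n / 4) ^ k"
    by (rule mult_right_mono) simp
  also have "\<dots> = ((1 - 2 * \<eta>) * real m) ^ k * ((1 - 2 * \<eta>) * (real n / 4)) ^ k"
    by (simp add: power_add power_mult_distrib power_divide mult_ac)
  also have "\<dots> \<le> real (m - 2 * k) ^ k * real (D - 2 * k) ^ k"
    using 1 2 \<theta> by (intro mult_mono power_mono) auto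
  also note lam
  finally show ?thesis .
qed

section \<open>Passing to o(1) and the two growth conditions\<close>

lemma exists_smallo_lower_bound:
  fixes f g :: "nat \<Rightarrow> real"
  assumes pos: "\<forall>\<^sub>F n in sequentially. g n > 0"
    and ge: "\<And>\<delta>. 0 < \<delta> \<Longrightarrow> \<delta> < 1 \<Longrightarrow> \<forall>\<^sub>F n in sequentially. (1 - \<delta>) * g n \<le> f n"
  shows "\<exists>\<epsilon> :: nat \<Rightarrow> real. \<epsilon> \<in> o(\<lambda>_. 1) \<and> (\<forall>\<^sub>F n in sequentially. f n \<ge> (1 + \<epsilon> n) * g n)"
proof (intro exI conjI)
  \<comment> \<open>Only a lower bound on \<open>f\<close> is known, so the relative error is capped
    at 0 to make it tend to 0 even where \<open>f\<close> exceeds \<open>g\<close> by far.\<close>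
  let ?\<epsilon> = "\<lambda>n. min 0 (f n / g n - 1)"
  show "?\<epsilon> \<in> o(\<lambda>_. 1)"
  proof (rule landau_o.smallI)
    fix c :: real assume "c > 0"
    then have "\<forall>\<^sub>F n in sequentially. (1 - min c (1/2)) * g n \<le> f n" by (intro ge) auto
    with pos show "\<forall>\<^sub>F n in sequentially. norm (?\<epsilon> n) \<le> c * norm (1::real)"
    proof eventually_elim
      case (elim n)
      then have "1 - min c (1/2) \<le> f n / g n" by (simp add: pos_le_divide_eq)
      then show ?case using \<open>c > 0\<close> by (simp add: min_def split: if_splits)
    qed
  qed
  show "\<forall>\<^sub>F n in sequentially. f n \<ge> (1 + ?\<epsilon> n) * g n"
    using pos
  proof eventually_elim
    case (elim n)
    then have "(1 + ?\<epsilon> n) * g n \<le> f n / g n * g n" by (intro mult_right_mono) auto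
    then show ?case using elim by simp
  qed
qed

theorem theorem4p1:
  fixes k :: nat and m :: "nat \<Rightarrow> nat"
  assumes "k \<ge> 1" and "\<And>n. m n \<le> n"
  shows "(filterlim (\<lambda>n. real (m n) / ln (real n)) at_top sequentially \<longrightarrow>
           (\<exists>\<epsilon> :: nat \<Rightarrow> real. \<epsilon> \<in> o(\<lambda>_. 1) \<and>
             (\<forall>\<^sub>F n in sequentially.
               real (alt_lambda (2 * k) (m n) n)
                 \<ge> (1 + \<epsilon> n) * (real (m n) ^ k * real n ^ (k - 1) / 2 ^ (2 * k - 1)))))
       \<and> ((\<lambda>n. real (m n)) \<in> \<omega>(\<lambda>_. 1) \<longrightarrow>
           (\<exists>\<epsilon> :: nat \<Rightarrow> real. \<epsilon> \<in> o(\<lambda>_. 1) \<and>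
             (\<forall>\<^sub>F n in sequentially.
               real (alt_lambda (2 * k + 1) (m n) n)
                 \<ge> (1 + \<epsilon> n) * (real (m n) * real n / 4) ^ k)))"
proof (intro conjI impI)
  assume lim: "filterlim (\<lambda>n. real (m n) / ln (real n)) at_top sequentially"
  \<comment> \<open>From \<open>n = 3\<close> on, \<open>ln n\<close> is at least 1, so
    \<open>C * ln n \<le> m n\<close> also yields \<open>C \<le> m n\<close>.\<close>
  have large: "\<forall>\<^sub>F n in sequentially. n \<ge> 3 \<and> C * ln (real n) \<le> real (m n) \<and> C \<le> real (m n)"
    if "C \<ge> 0" for C :: real
    using eventually_ge_at_top[of 3] lim[unfolded filterlim_at_top, rule_format, of C]
  proof eventually_elim
    case (elim n)
    have "exp 1 \<le> real n" using exp_le elim(1) by linarith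
    then have ln: "1 \<le> ln (real n)" using elim(1) by (simp add: ln_ge_iff)
    then have "C * ln (real n) \<le> real (m n)" using elim(2) by (simp add: field_simps)
    moreover have "C * 1 \<le> C * ln (real n)" using ln that by (intro mult_left_mono)
    ultimately show ?case using elim(1) by auto
  qed
  show "\<exists>\<epsilon> :: nat \<Rightarrow> real. \<epsilon> \<in> o(\<lambda>_. 1) \<and> (\<forall>\<^sub>F n in sequentially.
      real (alt_lambda (2 * k) (m n) n)
        \<ge> (1 + \<epsilon> n) * (real (m n) ^ k * real n ^ (k - 1) / 2 ^ (2 * k - 1)))"
  proof (rule exists_smallo_lower_bound)
    show "\<forall>\<^sub>F n in sequentially. 0 < real (m n) ^ k * real n ^ (k - 1) / 2 ^ (2 * k - 1)"
      using large[of 1, simplified] by eventually_elim (auto intro!: divide_pos_pos mult_pos_pos)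
    fix \<delta> :: real assume \<delta>: "0 < \<delta>" "\<delta> < 1"
    \<comment> \<open>The total relative loss \<open>4 * k * \<eta>\<close> becomes exactly
      \<open>\<delta>\<close>.\<close>
    define \<eta> where "\<eta> = \<delta> / (4 * real k)"
    have \<eta>: "0 < \<eta>" "\<eta> \<le> 1/4" "\<delta> = 4 * real k * \<eta>"
      using \<delta> assms(1) by (auto simp: \<eta>_def field_simps)
    show "\<forall>\<^sub>F n in sequentially. (1 - \<delta>) * (real (m n) ^ k * real n ^ (k - 1) / 2 ^ (2 * k - 1))
        \<le> real (alt_lambda (2 * k) (m n) n)"
      \<comment> \<open>The code requires \<open>\<eta>\<^sup>2 * m > 64 * ln n\<close>; the
        constant 65 makes this strict, as \<open>ln n\<close> is positive.\<close>
      using large[of "8 * real k / \<eta>", OF divide_nonneg_pos[OF _ \<eta>(1)], simplified]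
        large[of "65 / \<eta>\<^sup>2", simplified]
    proof eventually_elim
      case (elim n)
      have "0 < ln (real n)" using elim by simp
      moreover have "65 * ln (real n) \<le> \<eta>\<^sup>2 * real (m n)"
        using elim \<eta>(1) by (simp add: field_simps)
      ultimately have "2 * ln (real n) - \<eta>\<^sup>2 * real (m n) / 32 < 0" by linarith
      then have "exp (2 * ln (real n) - \<eta>\<^sup>2 * real (m n) / 32) < 1" by simp
      also have "exp (2 * ln (real n) - \<eta>\<^sup>2 * real (m n) / 32) =
          exp (real 2 * ln (real n)) * exp (- (\<eta>\<^sup>2 * real (m n) / 32))"
        by (simp flip: exp_add)
      also have "exp (real 2 * ln (real n)) = real n ^ 2"
        using elim by (subst exp_of_nat_mult) simp
      finally have "real n ^ 2 * exp (- (\<eta>\<^sup>2 * real (m n) / 32)) < 1" .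
      moreover have "real (m n) \<le> real n" using assms(2) by simp
      ultimately show ?case
        unfolding \<eta>(3) using elim \<eta> assms(1) by (intro alt_lambda_even_ge_asymptotic) auto
    qed
  qed
next
  assume "(\<lambda>n. real (m n)) \<in> \<omega>(\<lambda>_. 1)"
  then have large: "\<forall>\<^sub>F n in sequentially. C \<le> real (m n)" if "C > 0" for C :: real
    using landau_omega.smallD[of "\<lambda>n. real (m n)" sequentially "\<lambda>_. 1" C] that by simp
  show "\<exists>\<epsilon> :: nat \<Rightarrow> real. \<epsilon> \<in> o(\<lambda>_. 1) \<and> (\<forall>\<^sub>F n in sequentially.
      real (alt_lambda (2 * k + 1) (m n) n) \<ge> (1 + \<epsilon> n) * (real (m n) * real n / 4) ^ k)"
  proof (rule exists_smallo_lower_bound)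
    show "\<forall>\<^sub>F n in sequentially. 0 < (real (m n) * real n / 4) ^ k"
      using large[of 1, simplified] eventually_gt_at_top[of 0] by eventually_elim auto
    fix \<delta> :: real assume \<delta>: "0 < \<delta>" "\<delta> < 1"
    define \<eta> where "\<eta> = \<delta> / (4 * real k)"
    have \<eta>: "0 < \<eta>" "\<eta> \<le> 1/4" "\<delta> = 4 * real k * \<eta>"
      using \<delta> assms(1) by (auto simp: \<eta>_def field_simps)
    \<comment> \<open>The code now has \<open>m n \<le> n\<close> rows and \<open>n\<close> columns,
      so exponential decay in \<open>n\<close> beats the number of pairs; the growth of
      \<open>m\<close> makes the \<open>2 * k\<close> excluded vertices negligible.\<close>
    have "(\<lambda>n. real n ^ 2 * exp (- (\<eta>\<^sup>2 * real n / 32))) \<longlonglongrightarrow> 0"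
      using \<eta>(1) by real_asymp
    then have "\<forall>\<^sub>F n in sequentially. real n ^ 2 * exp (- (\<eta>\<^sup>2 * real n / 32)) < 1"
      by (rule order_tendstoD) simp
    moreover have "8 * real k / \<eta> > 0" using \<eta>(1) assms(1) by simp
    note large[OF this]
    ultimately show "\<forall>\<^sub>F n in sequentially.
        (1 - \<delta>) * (real (m n) * real n / 4) ^ k \<le> real (alt_lambda (2 * k + 1) (m n) n)"
    proof eventually_elim
      case (elim n)
      have mn: "real (m n) \<le> real n" using assms(2) by simp
      then have "real (m n) ^ 2 * exp (- (\<eta>\<^sup>2 * real n / 32))
          \<le> real n ^ 2 * exp (- (\<eta>\<^sup>2 * real n / 32))"
        by (intro mult_right_mono power_mono) auto
      also note elim(1)
      finally show ?case
        unfolding \<eta>(3) using elim \<eta> mn assms(1) by (intro alt_lambda_odd_ge_asymptotic) auto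
    qed
  qed
qed

end
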